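(* For any constant $\varepsilon>0$, the integrality gap of the linear program (LP) below for Weighted $k$-Server on the uniform metric is unbounded even with $(\ell-\varepsilon)$-resource augmentation, where $\ell$ is the number of distinct server weights. That is, the ratio between the minimum cost of an integral solution using $\lfloor(\ell-\varepsilon)k_j\rfloor$ servers of weight $W_j$ for each $j\in[\ell]$ and the optimal value of (LP) (with the original numbers $k_j$) is not bounded by any constant over all instances. (LP): variables $x_{v,j,t}\ge 0$ for $v\in V$, $j\in[\ell]$, times $t$; minimize $\frac12\sum_{j\in[\ell]}W_j\sum_t\sum_{v\in V}|x_{v,j,t}-x_{v,j,t-1}|$ subject to $\sum_{v\in V}x_{v,j,t}\le k_j$ for all $t$ and $j\in[\ell]$, and $\sum_{j\in[\ell]}x_{\sigma_t,j,t}\ge 1$ for all $t$.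
   Context: Weighted $k$-Server on the uniform metric: there is a set of $n$ points $V=\{1,\dots,n\}$ with $d(v,v')=1$ for all $v\neq v'$, and $k$ servers, server $i$ having weight $w_i\ge 0$. A request sequence $\sigma_1,\dots,\sigma_T\in V$ is given. A solution is a map $f:[k]\times\{0,\dots,T\}\to V$ giving the position of each server at each time, with given initial positions $f(i,0)$, such that for each $t\in[T]$ some server $i_t$ has $f(i_t,t)=\sigma_t$. Its cost is $\frac12\sum_{i=1}^k w_i\sum_{t=1}^T\mathbb{1}[f(i,t)\neq f(i,t-1)]$. The distinct weights are $W_1,\dots,W_\ell$ (the $\ell$ weight classes), with $k_j$ servers of weight $W_j$. $c$-resource augmentation means using $\lfloor ck_j\rfloor$ servers of weight $W_j$ for each $j$. In (LP), $x_{v,j,t}$ represents the fractional mass of weight-$W_j$ servers at point $v$ at time $t$. *)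

theory Defs
  imports Complex_Main "HOL-Library.Extended_Real" "HOL-Library.FuncSet"
begin

text \<open>
  An instance of Weighted \<open>k\<close>-Server on the uniform metric with point set \<open>{1..npts}\<close>.
  Servers are grouped by weight class: server \<open>(j, i)\<close> is the \<open>i\<close>-th server of the
  class \<open>j \<in> {1..ncls}\<close> and has weight \<open>wt j\<close>, so that \<open>num j\<close> is the number \<open>k\<^sub>j\<close> of
  servers of weight \<open>W\<^sub>j\<close>. The requests are \<open>req 1, \<dots>, req horizon\<close>.
\<close>

record wks =
  npts :: nat
  ncls :: nat
  wt :: "nat \<Rightarrow> real"
  num :: "nat \<Rightarrow> nat"
  horizon :: nat
  req :: "nat \<Rightarrow> nat"
  start :: "nat \<times> nat \<Rightarrow> nat"

definition points :: "wks \<Rightarrow> nat set" where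
  "points I = {1..npts I}"

definition classes :: "wks \<Rightarrow> nat set" where
  "classes I = {1..ncls I}"

definition servers :: "wks \<Rightarrow> (nat \<times> nat) set" where
  "servers I = (SIGMA j:classes I. {1..num I j})"

text \<open>
  Injectivity of \<open>wt\<close> and nonemptiness of every class make \<open>ncls\<close> the number of distinct
  server weights.
\<close>

definition wks_instance :: "wks \<Rightarrow> bool" where
  "wks_instance I \<longleftrightarrow>
     inj_on (wt I) (classes I) \<and>
     (\<forall>j\<in>classes I. 0 \<le> wt I j \<and> 1 \<le> num I j) \<and>
     (\<forall>t\<in>{1..horizon I}. req I t \<in> points I) \<and>
     start I \<in> servers I \<rightarrow> points I"

definition solution :: "wks \<Rightarrow> (nat \<times> nat \<Rightarrow> nat \<Rightarrow> nat) \<Rightarrow> bool" where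
  "solution I f \<longleftrightarrow>
     (\<forall>s\<in>servers I. \<forall>t\<in>{0..horizon I}. f s t \<in> points I) \<and>
     (\<forall>s\<in>servers I. f s 0 = start I s) \<and>
     (\<forall>t\<in>{1..horizon I}. \<exists>s\<in>servers I. f s t = req I t)"

definition cost :: "wks \<Rightarrow> (nat \<times> nat \<Rightarrow> nat \<Rightarrow> nat) \<Rightarrow> real" where
  "cost I f =
     1 / 2 * (\<Sum>s\<in>servers I. wt I (fst s) *
       (\<Sum>t = 1..horizon I. of_bool (f s t \<noteq> f s (t - 1))))"

text \<open>The optimum is \<open>\<infinity>\<close> if there is no solution.\<close>

definition int_opt :: "wks \<Rightarrow> ereal" where
  "int_opt I = (INF f \<in> {f. solution I f}. ereal (cost I f))"

text \<open>
  The fractional solution starts, like the integral one, in the given initial configuration: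
  \<open>x v j 0\<close> is the number of servers of class \<open>j\<close> that are initially at \<open>v\<close>.
\<close>

definition lp_feasible :: "wks \<Rightarrow> (nat \<Rightarrow> nat \<Rightarrow> nat \<Rightarrow> real) \<Rightarrow> bool" where
  "lp_feasible I x \<longleftrightarrow>
     (\<forall>v\<in>points I. \<forall>j\<in>classes I. \<forall>t\<in>{0..horizon I}. 0 \<le> x v j t) \<and>
     (\<forall>v\<in>points I. \<forall>j\<in>classes I. x v j 0 = real (card {i\<in>{1..num I j}. start I (j, i) = v})) \<and>
     (\<forall>j\<in>classes I. \<forall>t\<in>{0..horizon I}. (\<Sum>v\<in>points I. x v j t) \<le> real (num I j)) \<and>
     (\<forall>t\<in>{1..horizon I}. (\<Sum>j\<in>classes I. x (req I t) j t) \<ge> 1)"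

definition lp_cost :: "wks \<Rightarrow> (nat \<Rightarrow> nat \<Rightarrow> nat \<Rightarrow> real) \<Rightarrow> real" where
  "lp_cost I x =
     1 / 2 * (\<Sum>j\<in>classes I. wt I j *
       (\<Sum>t = 1..horizon I. \<Sum>v\<in>points I. \<bar>x v j t - x v j (t - 1)\<bar>))"

definition lp_opt :: "wks \<Rightarrow> ereal" where
  "lp_opt I = (INF x \<in> {x. lp_feasible I x}. ereal (lp_cost I x))"

text \<open>
  The instance seen by an integral solution with \<open>c\<close>-resource augmentation. The initial
  positions of the original servers do not determine those of the augmented ones, so the
  latter are a separate argument.
\<close>

definition augment :: "real \<Rightarrow> (nat \<times> nat \<Rightarrow> nat) \<Rightarrow> wks \<Rightarrow> wks" where
  "augment c g I = I\<lparr>num := (\<lambda>j. nat \<lfloor>c * real (num I j)\<rfloor>), start := g\<rparr>"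

end

theory Submission
  imports Defs "HOL-Library.Sublist"
begin

text \<open>
  Let \<open>n\<^sub>0 = 1\<close> and \<open>n\<^sub>j = l k\<^sub>j\<close>, where the \<open>k\<^sub>j\<close> grow so fast that \<open>\<epsilon> k\<^sub>j \<ge> n\<^sub>j\<^sub>-\<^sub>1\<close>. A phase of level
  \<open>j\<close> on a set \<open>S\<close> of \<open>n\<^sub>j\<close> points consists of \<open>m\<close> rounds, each of which runs a phase of level
  \<open>j - 1\<close> on every \<open>n\<^sub>j\<^sub>-\<^sub>1\<close>-element subset of \<open>S\<close>; a phase of level \<open>0\<close> requests a single point.
  The fractional solution enters such a phase by spreading class \<open>j\<close> over \<open>S\<close> with mass \<open>1 / l\<close>
  per point, so at every request all \<open>l\<close> classes contribute \<open>1 / l\<close>. With weights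
  \<open>W\<^sub>j = 2 m\<^sup>j\<^sup>-\<^sup>1\<close> its total cost is \<open>O(m\<^sup>l\<^sup>-\<^sup>1)\<close>.

  An integral solution with \<open>(l - \<epsilon>) k\<^sub>j\<close> servers in class \<open>j\<close> whose heavier servers avoid \<open>S\<close>
  pays at least \<open>m\<^sup>j\<close> for the phase: in each round either a server of class \<open>j\<close> moves, at cost
  \<open>W\<^sub>j / 2 = m\<^sup>j\<^sup>-\<^sup>1\<close>, or class \<open>j\<close> stays put and leaves some \<open>n\<^sub>j\<^sub>-\<^sub>1\<close>-element subset of \<open>S\<close> free,
  and then the phase on that subset costs \<open>m\<^sup>j\<^sup>-\<^sup>1\<close> by induction. Hence the ratio is of order \<open>m\<close>.
\<close>

section \<open>Costs of configuration sequences\<close>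

fun path_cost :: "('c \<Rightarrow> 'c \<Rightarrow> real) \<Rightarrow> 'c \<Rightarrow> 'c list \<Rightarrow> real" where
  "path_cost d c [] = 0"
| "path_cost d c (x # xs) = d c x + path_cost d x xs"

lemma path_cost_append:
  "path_cost d c (xs @ ys) = path_cost d c xs + path_cost d (last (c # xs)) ys"
  by (induction xs arbitrary: c) auto

lemma path_cost_nonneg:
  assumes "\<And>c c'. 0 \<le> d c c'"
  shows "0 \<le> path_cost d c xs"
  by (induction xs arbitrary: c) (auto simp: assms)

lemma path_cost_eq_sum:
  "path_cost d (g a) (map g [Suc a..<Suc (a + n)]) = (\<Sum>t = Suc a..a + n. d (g (t - 1)) (g t))"
  by (induction n) (simp_all add: path_cost_append last_map del: upt_Suc add: upt_Suc_append)

text \<open>Only the first step of the path changes. This allows a fictitious configuration to be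
  inserted before a phase.\<close>

lemma path_cost_triangle:
  assumes "\<And>c c'. 0 \<le> d c c'" and "\<And>x y z. d x z \<le> d x y + d y z"
  shows "path_cost d x zs \<le> d x y + path_cost d y zs"
  using assms(1)[of x y] assms(2)[of x _ y] by (cases zs) auto

text \<open>Each block starts at the last configuration visited before it, so \<open>Inv\<close> is
  available there and \<open>B\<close> applies block by block.\<close>

lemma path_cost_concat_le:
  assumes "Inv c"
    and "\<And>xs c. xs \<in> set xss \<Longrightarrow> Inv c \<Longrightarrow> path_cost d c xs \<le> B"
    and "\<And>xs x. xs \<in> set xss \<Longrightarrow> x \<in> set xs \<Longrightarrow> Inv x"
  shows "path_cost d c (concat xss) \<le> real (length xss) * B"
  using assms
proof (induction xss arbitrary: c)
  case (Cons xs xss)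
  have "last (c # xs) \<in> insert c (set xs)"
    using last_in_set[of "c # xs"] by simp
  then have "Inv (last (c # xs))"
    using Cons.prems(1,3) by (metis insert_iff list.set_intros(1))
  then have "path_cost d (last (c # xs)) (concat xss) \<le> real (length xss) * B"
    using Cons.prems by (intro Cons.IH) auto
  moreover have "path_cost d c xs \<le> B"
    using Cons.prems by simp
  ultimately show ?case
    by (simp add: path_cost_append algebra_simps del: last.simps)
qed simp

lemma path_cost_replicate_ge:
  assumes "\<And>c cs. list_all2 P cs ys \<Longrightarrow> B \<le> path_cost d c cs"
    and "list_all2 P cs (concat (replicate m ys))"
  shows "real m * B \<le> path_cost d c cs"
  using assms(2)
proof (induction m arbitrary: c cs)
  case (Suc m)
  then obtain us vs where cs: "cs = us @ vs" and us: "list_all2 P us ys"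
    and vs: "list_all2 P vs (concat (replicate m ys))"
    by (auto simp: list_all2_append2)
  show ?case
    using assms(1)[OF us, of c] Suc.IH[OF vs, of "last (c # us)"]
    by (simp add: cs path_cost_append algebra_simps del: last.simps)
qed simp

text \<open>Whatever precedes or follows the chosen block costs at least 0. The premise
  \<open>set bs \<subseteq> set cs\<close> carries facts about a whole round into the block.\<close>

lemma path_cost_concat_member_ge:
  assumes "\<And>c c'. 0 \<le> d c c'" and "ys \<in> set yss" and "list_all2 P cs (concat yss)"
    and "\<And>c bs. set bs \<subseteq> set cs \<Longrightarrow> list_all2 P bs ys \<Longrightarrow> B \<le> path_cost d c bs"
  shows "B \<le> path_cost d c cs"
proof -
  obtain us vs where "yss = us @ ys # vs"
    using split_list[OF assms(2)] by blast
  then obtain as bs zs where cs: "cs = as @ bs @ zs" and bs: "list_all2 P bs ys"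
    using assms(3) by (auto simp: list_all2_append2)
  have "B \<le> path_cost d (last (c # as)) bs"
    using assms(4) bs cs by auto
  then show ?thesis
    using path_cost_nonneg[of d, OF assms(1)]
    by (simp add: cs path_cost_append add_increasing add_increasing2 del: last.simps)
qed

section \<open>The request sequence\<close>

text \<open>Point sets are encoded as lists, so that \<open>subseqs\<close> enumerates the subsets
  of a distinct \<open>S\<close> in a fixed order.\<close>

fun phase :: "(nat \<Rightarrow> nat) \<Rightarrow> nat \<Rightarrow> nat \<Rightarrow> nat list \<Rightarrow> nat list" where
  "phase n m 0 S = S"
| "phase n m (Suc j) S =
     concat (replicate m (concat (map (phase n m j) (filter (\<lambda>T. length T = n j) (subseqs S)))))"

lemma set_phase_subset: "set (phase n m j S) \<subseteq> set S"
proof (induction j arbitrary: S)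
  case (Suc j)
  have "set (phase n m j T) \<subseteq> set S" if "T \<in> set (subseqs S)" for T
    using Suc[of T] that PowI subseqs_powset[of S] by blast
  then show ?case
    by (auto split: if_splits)
qed simp

lemma phase_nonempty:
  assumes "m > 0" and "\<And>j. 0 < n j" and "\<And>j. n j \<le> n (Suc j)" and "length S = n j"
  shows "phase n m j S \<noteq> []"
  using assms(4)
proof (induction j arbitrary: S)
  case 0
  then show ?case using assms(2)[of 0] by auto
next
  case (Suc j)
  have "take (n j) S \<in> set (subseqs S)"
    by (simp add: in_set_subseqs prefix_imp_subseq take_is_prefix)
  moreover have "length (take (n j) S) = n j"
    using Suc.prems assms(3)[of j] by simp
  ultimately show ?case
    using Suc.IH[of "take (n j) S"] assms(1) by fastforce
qed

section \<open>Integral solutions\<close>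

definition move_cost ::
  "(nat \<times> nat) set \<Rightarrow> (nat \<Rightarrow> real) \<Rightarrow> (nat \<times> nat \<Rightarrow> nat) \<Rightarrow> (nat \<times> nat \<Rightarrow> nat) \<Rightarrow> real"
  where "move_cost A w p q = 1 / 2 * (\<Sum>s\<in>A. w (fst s) * of_bool (q s \<noteq> p s))"

lemma move_cost_nonneg: "(\<And>j. 0 \<le> w j) \<Longrightarrow> 0 \<le> move_cost A w p q"
  unfolding move_cost_def by (simp add: sum_nonneg)

text \<open>The first departure of \<open>s\<close> from \<open>p s\<close> already costs this much,
  and all other moves cost at least 0.\<close>

lemma path_cost_move_ge:
  assumes "finite A" and "\<And>j. 0 \<le> w j" and "s \<in> A" and "q \<in> set cs" and "q s \<noteq> p s"
  shows "w (fst s) / 2 \<le> path_cost (move_cost A w) p cs"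
  using assms(4,5)
proof (induction cs arbitrary: p)
  case (Cons r cs)
  show ?case
  proof (cases "r s = p s")
    case True
    then have "w (fst s) / 2 \<le> path_cost (move_cost A w) r cs"
      using Cons by auto
    then show ?thesis
      using move_cost_nonneg[of w A p r] assms(2) by simp
  next
    case False
    have "w (fst s) * of_bool (r s \<noteq> p s) \<le> (\<Sum>s\<in>A. w (fst s) * of_bool (r s \<noteq> p s))"
      using assms(1-3) by (intro member_le_sum) auto
    then have "w (fst s) / 2 \<le> move_cost A w p r"
      using False by (simp add: move_cost_def)
    moreover have "0 \<le> path_cost (move_cost A w) r cs"
      using assms(2) by (intro path_cost_nonneg move_cost_nonneg)
    ultimately show ?thesis by simp
  qed
qed simp

text \<open>\<open>few\<close> is the pigeonhole condition: class \<open>Suc j\<close>, if it stays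
  put, cannot hit every \<open>n j\<close>-element subset of a set of \<open>n (Suc j)\<close>
  points.\<close>

lemma phase_integral_cost_ge:
  assumes fin: "finite A" and cls: "\<And>s. s \<in> A \<Longrightarrow> 1 \<le> fst s"
    and n0: "n 0 = 1"
    and few: "\<And>j. card {s\<in>A. fst s = Suc j} + n j \<le> n (Suc j)"
    and w0: "\<And>j. 0 \<le> w j" and w: "\<And>j. 2 * real m ^ j \<le> w (Suc j)"
    and "distinct S" and "length S = n j"
    and "list_all2 (\<lambda>p r. (\<exists>s\<in>A. p s = r) \<and> (\<forall>s\<in>A. j < fst s \<longrightarrow> p s \<notin> set S)) ps (phase n m j S)"
  shows "real m ^ j \<le> path_cost (move_cost A w) p ps"
  using assms(7-)
proof (induction j arbitrary: S p ps)
  case 0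
  then obtain v where "S = [v]"
    using n0 by (auto simp: length_Suc_conv)
  \<comment> \<open>Every server has class at least 1 and so must avoid the point \<open>v\<close>,
    yet one of them has to serve it: no such \<open>ps\<close> exists.\<close>
  then have False
    using 0 cls by (force simp: list_all2_Cons2)
  then show ?case ..
next
  case (Suc j)
  let ?P = "\<lambda>p r. (\<exists>s\<in>A. p s = r) \<and> (\<forall>s\<in>A. Suc j < fst s \<longrightarrow> p s \<notin> set S)"
  let ?d = "move_cost A w"
  let ?Ts = "filter (\<lambda>T. length T = n j) (subseqs S)"
  \<comment> \<open>A single round is bounded from an arbitrary start; the \<open>m\<close>
    repetitions supply the remaining factor.\<close>
  have "real m ^ j \<le> path_cost ?d p ps"
    if ps: "list_all2 ?P ps (concat (map (phase n m j) ?Ts))" for p ps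
  proof (cases "\<exists>q\<in>set ps. \<exists>s\<in>A. fst s = Suc j \<and> q s \<noteq> p s")
    case True
    then obtain q s where "q \<in> set ps" "s \<in> A" "fst s = Suc j" "q s \<noteq> p s"
      by blast
    then show ?thesis
      using path_cost_move_ge[OF fin, of w, where p = p and q = q and s = s and cs = ps] w0 w[of j]
      by simp
  next
    case False
    \<comment> \<open>Class \<open>Suc j\<close> occupies exactly \<open>U\<close> throughout this
      round, and \<open>T\<close> consists of \<open>n j\<close> points of \<open>S\<close> that it
      leaves free.\<close>
    define U where "U = p ` {s\<in>A. fst s = Suc j}"
    define T where "T = take (n j) (filter (\<lambda>v. v \<notin> U) S)"
    have "card U + n j \<le> n (Suc j)"
      using few[of j] card_image_le[of "{s\<in>A. fst s = Suc j}" p] fin by (simp add: U_def)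
    moreover have "length (filter (\<lambda>v. v \<in> U) S) \<le> card U"
      using Suc.prems(1) fin
      by (subst distinct_card[symmetric]) (auto intro!: card_mono simp: U_def)
    ultimately have len: "length T = n j"
      using sum_length_filter_compl[of "\<lambda>v. v \<in> U" S] Suc.prems(2) by (simp add: T_def)
    have "subseq T (filter (\<lambda>v. v \<notin> U) S)"
      by (simp add: T_def prefix_imp_subseq take_is_prefix)
    then have "subseq T S"
      using subseq_filter_left subseq_order.order_trans by blast
    then have T: "phase n m j T \<in> set (map (phase n m j) ?Ts)"
      using len by (auto simp: in_set_subseqs)
    have sub: "set T \<subseteq> set S - U"
      using set_take_subset by (fastforce simp: T_def)
    have "distinct T"
      using Suc.prems(1) by (simp add: T_def)
    show ?thesis
    proof (rule path_cost_concat_member_ge[OF move_cost_nonneg[OF w0] T ps])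
      fix q qs
      assume qs: "set qs \<subseteq> set ps" "list_all2 ?P qs (phase n m j T)"
      have "q' s \<notin> set T" if "q' \<in> set qs" "s \<in> A" "fst s = Suc j" for q' s
      proof -
        have "q' s = p s" using False qs(1) that by blast
        then show ?thesis using sub that by (auto simp: U_def)
      qed
      then have "list_all2 (\<lambda>p r. (\<exists>s\<in>A. p s = r) \<and> (\<forall>s\<in>A. j < fst s \<longrightarrow> p s \<notin> set T)) qs (phase n m j T)"
        using qs(2) sub unfolding list_all2_conv_all_nth
        by (metis (no_types, lifting) DiffD1 Suc_lessI nth_mem subsetD)
      then show "real m ^ j \<le> path_cost ?d q qs"
        using Suc.IH \<open>distinct T\<close> len by blast
    qed
  qed
  then show ?case
    using path_cost_replicate_ge[where P = ?P and B = "real m ^ j" and m = m and d = ?d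
        and ys = "concat (map (phase n m j) ?Ts)"] Suc.prems(3)
    by simp
qed

section \<open>Fractional solutions\<close>

text \<open>The class comes before the point, unlike in the LP variables, so that one function
  update replaces a whole class.\<close>

type_synonym fconfig = "nat \<Rightarrow> nat \<Rightarrow> real"

definition frac_cost :: "nat set \<Rightarrow> nat \<Rightarrow> (nat \<Rightarrow> real) \<Rightarrow> fconfig \<Rightarrow> fconfig \<Rightarrow> real" where
  "frac_cost V l w c c' = 1 / 2 * (\<Sum>i = 1..l. w i * (\<Sum>v\<in>V. \<bar>c' i v - c i v\<bar>))"

lemma frac_cost_nonneg: "(\<And>i. 0 \<le> w i) \<Longrightarrow> 0 \<le> frac_cost V l w c c'"
  unfolding frac_cost_def by (simp add: sum_nonneg)

lemma frac_cost_triangle: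
  assumes "\<And>i. 0 \<le> w i"
  shows "frac_cost V l w x z \<le> frac_cost V l w x y + frac_cost V l w y z"
proof -
  have "(\<Sum>i = 1..l. w i * (\<Sum>v\<in>V. \<bar>z i v - x i v\<bar>))
      \<le> (\<Sum>i = 1..l. w i * (\<Sum>v\<in>V. \<bar>y i v - x i v\<bar> + \<bar>z i v - y i v\<bar>))"
    using assms by (intro sum_mono mult_left_mono) auto
  then show ?thesis
    by (simp add: frac_cost_def sum.distrib distrib_left)
qed

definition frac_valid :: "nat set \<Rightarrow> nat \<Rightarrow> (nat \<Rightarrow> nat) \<Rightarrow> fconfig \<Rightarrow> bool" where
  "frac_valid V l k c \<longleftrightarrow> (\<forall>i\<in>{1..l}. (\<forall>v. 0 \<le> c i v) \<and> (\<Sum>v\<in>V. c i v) \<le> real (k i))"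

text \<open>By \<open>\<bar>y - c\<bar> \<le> y + c\<close>, the change is at most the old plus the
  new mass, that is \<open>2 * k j\<close>; the factor 1/2 in the cost cancels the 2.\<close>

lemma frac_cost_fun_upd_le:
  assumes "finite V" and "\<And>i. 0 \<le> w i" and "j \<in> {1..l}"
    and c: "frac_valid V l k c" and c': "frac_valid V l k (c(j := y))"
  shows "frac_cost V l w c (c(j := y)) \<le> w j * real (k j)"
proof -
  have "(\<Sum>v\<in>V. \<bar>y v - c j v\<bar>) \<le> (\<Sum>v\<in>V. y v + c j v)"
    using c c' assms(3) by (intro sum_mono) (force simp: frac_valid_def abs_le_iff add_increasing)
  also have "\<dots> \<le> 2 * real (k j)"
    using c c' assms(3) by (force simp: frac_valid_def sum.distrib)
  finally have *: "w j * (\<Sum>v\<in>V. \<bar>y v - c j v\<bar>) \<le> w j * (2 * real (k j))"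
    using assms(2) by (intro mult_left_mono)
  have "(\<Sum>i = 1..l. w i * (\<Sum>v\<in>V. \<bar>(c(j := y)) i v - c i v\<bar>))
      = (\<Sum>i = 1..l. if i = j then w j * (\<Sum>v\<in>V. \<bar>y v - c j v\<bar>) else 0)"
    by (intro sum.cong) auto
  then show ?thesis
    using * assms(3) by (simp add: frac_cost_def)
qed

definition spread :: "nat \<Rightarrow> nat list \<Rightarrow> nat \<Rightarrow> real" where
  "spread l S v = of_bool (v \<in> set S) / real l"

lemma sum_spread_le:
  assumes "finite V"
  shows "(\<Sum>v\<in>V. spread l S v) \<le> real (length S) / real l"
proof -
  have "(\<Sum>v\<in>V. spread l S v) = real (card (V \<inter> set S)) / real l"
    using assms by (simp add: spread_def sum_divide_distrib[symmetric] Int_def)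
  moreover have "card (V \<inter> set S) \<le> length S"
    using card_mono[of "set S" "V \<inter> set S"] card_length[of S] by simp
  ultimately show ?thesis
    by (simp add: divide_right_mono)
qed

text \<open>
  The argument \<open>c\<close> matters only on classes above \<open>j\<close>; the phase overwrites the others.
\<close>

fun schedule :: "nat \<Rightarrow> (nat \<Rightarrow> nat) \<Rightarrow> nat \<Rightarrow> nat \<Rightarrow> fconfig \<Rightarrow> nat list \<Rightarrow> fconfig list" where
  "schedule l n m 0 c S = [c]"
| "schedule l n m (Suc j) c S =
     concat (replicate m (concat (map (schedule l n m j (c(Suc j := spread l S)))
       (filter (\<lambda>T. length T = n j) (subseqs S)))))"

lemma schedule_higher_classes:
  "c' \<in> set (schedule l n m j c S) \<Longrightarrow> j < i \<Longrightarrow> c' i = c i"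
proof (induction j arbitrary: c S)
  case (Suc j)
  then obtain T where "c' \<in> set (schedule l n m j (c(Suc j := spread l S)) T)"
    by (auto split: if_splits)
  then show ?case
    using Suc.IH Suc.prems(2) by fastforce
qed simp

lemma frac_valid_spread:
  assumes "finite V" and "0 < l" and "frac_valid V l k c" and "length S = l * k j"
  shows "frac_valid V l k (c(j := spread l S))"
  using assms sum_spread_le[of V l S] by (auto simp: frac_valid_def spread_def)

lemma schedule_valid:
  assumes "finite V" and "0 < l" and "\<And>j. n (Suc j) = l * k (Suc j)"
    and "frac_valid V l k c" and "length S = n j" and "c' \<in> set (schedule l n m j c S)"
  shows "frac_valid V l k c'"
  using assms(4-)
proof (induction j arbitrary: c S)
  case (Suc j)
  then obtain T where "length T = n j" "c' \<in> set (schedule l n m j (c(Suc j := spread l S)) T)"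
    by (auto split: if_splits)
  moreover have "frac_valid V l k (c(Suc j := spread l S))"
    using Suc.prems assms(1-3) by (intro frac_valid_spread) auto
  ultimately show ?case
    using Suc.IH by blast
qed simp

text \<open>Going down the levels, \<open>spread\<close> adds class \<open>Suc j\<close> to those
  already holding \<open>1 / l\<close> on the current set; at level 0 all \<open>l\<close> classes
  do.\<close>

lemma schedule_serves:
  assumes "0 < l" and n0: "n 0 = 1" and "j \<le> l" and "length S = n j"
    and "\<And>i v. j < i \<Longrightarrow> i \<le> l \<Longrightarrow> v \<in> set S \<Longrightarrow> 1 / real l \<le> c i v"
  shows "list_all2 (\<lambda>c' r. 1 \<le> (\<Sum>i = 1..l. c' i r)) (schedule l n m j c S) (phase n m j S)"
  using assms(3-)
proof (induction j arbitrary: c S)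
  case 0
  then obtain v where v: "S = [v]"
    using n0 by (auto simp: length_Suc_conv)
  have "(\<Sum>i = 1..l. 1 / real l) \<le> (\<Sum>i = 1..l. c i v)"
    using 0(3) v by (intro sum_mono) auto
  then show ?case
    using v assms(1) by simp
next
  case (Suc j)
  let ?P = "\<lambda>c' r. 1 \<le> (\<Sum>i = 1..l. c' i r)"
  let ?c = "c(Suc j := spread l S)"
  let ?Ts = "filter (\<lambda>T. length T = n j) (subseqs S)"
  have "list_all2 ?P (schedule l n m j ?c T) (phase n m j T)" if T: "T \<in> set ?Ts" for T
  proof (rule Suc.IH)
    fix i v assume i: "j < i" "i \<le> l" and "v \<in> set T"
    then have "v \<in> set S"
      using T subseqs_powset[of S] by auto
    then show "1 / real l \<le> ?c i v"
      using i Suc.prems(3)[of i v] by (auto simp: spread_def)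
  qed (use T Suc.prems in auto)
  then have "list_all2 ?P (concat (map (schedule l n m j ?c) ?Ts)) (concat (map (phase n m j) ?Ts))"
    by (intro concat_transfer[THEN rel_funD])
      (auto simp: list_all2_map1 list_all2_map2 intro!: list.rel_refl_strong)
  moreover have "list_all2 ?P (concat (replicate r xs)) (concat (replicate r ys))"
    if "list_all2 ?P xs ys" for r xs ys
    using that by (induction r) (auto intro: list_all2_appendI)
  ultimately show ?case
    by simp
qed

text \<open>The factor \<open>2 ^ n (Suc j)\<close> bounds the number of subphases in a round.\<close>

fun frac_bound :: "(nat \<Rightarrow> nat) \<Rightarrow> (nat \<Rightarrow> nat) \<Rightarrow> nat \<Rightarrow> real" where
  "frac_bound n k 0 = 0"
| "frac_bound n k (Suc j) = 2 * real (k (Suc j)) + 2 ^ n (Suc j) * frac_bound n k j"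

lemma frac_bound_nonneg: "0 \<le> frac_bound n k j"
  by (induction j) auto

text \<open>Here \<open>b\<close> is the configuration actually held before the phase and
  \<open>c\<close> the one passed to \<open>schedule\<close>. They may differ on classes up to
  \<open>j\<close>, because all subphases of a round receive the same \<open>c\<close> while each
  leaves the lower classes wherever it ended.\<close>

lemma schedule_cost_le:
  assumes V: "finite V" and l: "0 < l" and n: "\<And>j. n (Suc j) = l * k (Suc j)"
    and w: "\<And>j. w j = 2 * real m ^ (j - 1)"
    and "j \<le> l" and "length S = n j"
    and "frac_valid V l k c" and "frac_valid V l k b" and "\<And>i. j < i \<Longrightarrow> b i = c i"
  shows "path_cost (frac_cost V l w) b (schedule l n m j c S) \<le> frac_bound n k j * real m ^ (j - 1)"
  using assms(5-)
proof (induction j arbitrary: b c S)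
  case 0
  then show ?case
    by (simp add: frac_cost_def)
next
  case (Suc j)
  let ?d = "frac_cost V l w"
  let ?c = "c(Suc j := spread l S)"
  let ?b = "b(Suc j := spread l S)"
  let ?Ts = "filter (\<lambda>T. length T = n j) (subseqs S)"
  let ?B = "frac_bound n k j * real m ^ (j - 1)"
  let ?Inv = "\<lambda>b. frac_valid V l k b \<and> (\<forall>i>j. b i = ?c i)"
  have w0: "0 \<le> w i" for i
    by (simp add: w)
  have vc: "frac_valid V l k ?c" and vb: "frac_valid V l k ?b"
    using Suc.prems n by (auto intro!: frac_valid_spread V l)
  have B0: "0 \<le> ?B"
    by (simp add: frac_bound_nonneg)
  have Inv: "?Inv x" if "T \<in> set ?Ts" "x \<in> set (schedule l n m j ?c T)" for T x
    using that schedule_higher_classes schedule_valid[OF V l n vc] by fastforce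
  have round: "path_cost ?d b' (concat (map (schedule l n m j ?c) ?Ts)) \<le> 2 ^ n (Suc j) * ?B"
    if b': "?Inv b'" for b'
  proof -
    have "path_cost ?d b' (concat (map (schedule l n m j ?c) ?Ts))
        \<le> real (length (map (schedule l n m j ?c) ?Ts)) * ?B"
      using Suc.IH Suc.prems(1) vc Inv
      by (intro path_cost_concat_le[where Inv = ?Inv, OF b']) auto
    also have "\<dots> \<le> 2 ^ n (Suc j) * ?B"
    proof (rule mult_right_mono[OF _ B0])
      have "length ?Ts \<le> 2 ^ n (Suc j)"
        using length_filter_le[of _ "subseqs S"] Suc.prems(2) by (metis length_subseqs)
      then show "real (length (map (schedule l n m j ?c) ?Ts)) \<le> 2 ^ n (Suc j)"
        by simp
    qed
    finally show ?thesis .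
  qed
  have Invb: "?Inv ?b"
    using vb Suc.prems(5) by auto
  \<comment> \<open>Passing through \<open>?b\<close> charges the move of class \<open>Suc j\<close>
    onto \<open>S\<close> once; every round then starts with that class in place.\<close>
  have "path_cost ?d b (schedule l n m (Suc j) c S)
      \<le> ?d b ?b + path_cost ?d ?b (schedule l n m (Suc j) c S)"
    by (intro path_cost_triangle frac_cost_nonneg frac_cost_triangle w0)
  also have "?d b ?b \<le> w (Suc j) * real (k (Suc j))"
    using Suc.prems vb by (intro frac_cost_fun_upd_le V w0) auto
  also have "path_cost ?d ?b (schedule l n m (Suc j) c S)
      \<le> real (length (replicate m (concat (map (schedule l n m j ?c) ?Ts)))) * (2 ^ n (Suc j) * ?B)"
    unfolding schedule.simps
    by (rule path_cost_concat_le[where Inv = ?Inv, OF Invb]) (use round Inv in auto)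
  \<comment> \<open>The truncated exponent \<open>j - 1\<close> is harmless at \<open>j = 0\<close>,
    where \<open>frac_bound\<close> vanishes.\<close>
  also have "\<dots> = 2 ^ n (Suc j) * frac_bound n k j * real m ^ j"
    by (cases j) auto
  finally show ?case
    by (simp add: w algebra_simps)
qed

section \<open>The gap\<close>

text \<open>
  All servers start at a point that is never requested, which keeps the fractional optimum
  positive.
\<close>

definition gap_instance :: "nat \<Rightarrow> (nat \<Rightarrow> nat) \<Rightarrow> (nat \<Rightarrow> nat) \<Rightarrow> nat \<Rightarrow> wks" where
  "gap_instance l n k m =
     \<lparr>npts = Suc (n l), ncls = l, wt = (\<lambda>j. 2 * real m ^ (j - 1)), num = k,
      horizon = length (phase n m l [1..<Suc (n l)]),
      req = (\<lambda>t. phase n m l [1..<Suc (n l)] ! (t - 1)),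
      start = (\<lambda>_. Suc (n l))\<rparr>"

lemma gap_instance_req:
  assumes "t \<in> {1..horizon (gap_instance l n k m)}"
  shows "req (gap_instance l n k m) t \<in> {1..n l}"
proof -
  have "req (gap_instance l n k m) t \<in> set (phase n m l [1..<Suc (n l)])"
    using assms by (auto simp: gap_instance_def simp del: upt_Suc)
  then show ?thesis
    using set_phase_subset by fastforce
qed

lemma wks_instance_gap_instance:
  assumes "2 \<le> m" and "\<And>j. 1 \<le> k j"
  shows "wks_instance (gap_instance l n k m)"
proof -
  have "inj_on (\<lambda>j. 2 * real m ^ (j - 1)) {1..l}"
    using assms(1) by (auto intro!: inj_onI simp: power_inject_exp)
  moreover have "req (gap_instance l n k m) t \<in> points (gap_instance l n k m)"
    if "t \<in> {1..horizon (gap_instance l n k m)}" for t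
    using gap_instance_req[OF that] by (auto simp: points_def gap_instance_def simp del: upt_Suc)
  moreover have "start (gap_instance l n k m) \<in> servers (gap_instance l n k m) \<rightarrow> points (gap_instance l n k m)"
    by (auto simp: points_def gap_instance_def)
  ultimately show ?thesis
    using assms(2) unfolding wks_instance_def by (auto simp: classes_def gap_instance_def)
qed

text \<open>The start \<open>g\<close> is arbitrary since the phase bound holds from any
  configuration. At the top level \<open>l\<close> no class is heavier, so the avoidance condition
  is vacuous.\<close>

lemma int_opt_gap_instance_ge:
  assumes n0: "n 0 = 1" and few: "\<And>j. nat \<lfloor>c * real (k (Suc j))\<rfloor> + n j \<le> n (Suc j)"
  shows "ereal (real m ^ l) \<le> int_opt (augment c g (gap_instance l n k m))"
  unfolding int_opt_def
proof (rule INF_greatest, clarify)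
  let ?I = "augment c g (gap_instance l n k m)"
  let ?S = "[1..<Suc (n l)]"
  let ?R = "phase n m l ?S"
  let ?A = "servers ?I"
  let ?w = "\<lambda>j. 2 * real m ^ (j - 1)"
  fix f assume f: "solution ?I f"
  define ps where "ps = map (\<lambda>t s. f s t) [Suc 0..<Suc (0 + length ?R)]"
  have fin: "finite ?A"
    by (auto simp: servers_def classes_def)
  have cls: "1 \<le> fst s" "fst s \<le> l" if "s \<in> ?A" for s
    using that by (auto simp: servers_def classes_def augment_def gap_instance_def)
  have card: "card {s\<in>?A. fst s = Suc j} + n j \<le> n (Suc j)" for j
  proof -
    have "{s\<in>?A. fst s = Suc j} \<subseteq> {Suc j} \<times> {1..nat \<lfloor>c * real (k (Suc j))\<rfloor>}"
      by (auto simp: servers_def augment_def gap_instance_def)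
    then have "card {s\<in>?A. fst s = Suc j} \<le> card ({Suc j} \<times> {1..nat \<lfloor>c * real (k (Suc j))\<rfloor>})"
      by (intro card_mono) auto
    then show ?thesis
      using few[of j] by simp
  qed
  have "list_all2 (\<lambda>p r. (\<exists>s\<in>?A. p s = r) \<and> (\<forall>s\<in>?A. l < fst s \<longrightarrow> p s \<notin> set ?S)) ps ?R"
    unfolding list_all2_conv_all_nth
  proof (intro conjI allI impI)
    fix i assume "i < length ps"
    then have i: "Suc i \<in> {1..horizon ?I}" "i < length ?R"
      by (auto simp: ps_def augment_def gap_instance_def simp del: upt_Suc)
    then obtain s where "s \<in> ?A" "f s (Suc i) = req ?I (Suc i)"
      using f unfolding solution_def by blast
    then show "\<exists>s\<in>?A. (ps ! i) s = ?R ! i"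
      using i by (auto simp: ps_def augment_def gap_instance_def simp del: upt_Suc)
    show "\<forall>s\<in>?A. l < fst s \<longrightarrow> (ps ! i) s \<notin> set ?S"
      using cls(2) by fastforce
  qed (simp add: ps_def del: upt_Suc)
  then have "real m ^ l \<le> path_cost (move_cost ?A ?w) (\<lambda>s. f s 0) ps"
    using n0 by (intro phase_integral_cost_ge[where S = ?S and n = n, OF fin cls(1) _ card])
      (simp_all del: upt_Suc)
  also have "\<dots> = (\<Sum>t = 1..length ?R. move_cost ?A ?w (\<lambda>s. f s (t - 1)) (\<lambda>s. f s t))"
    unfolding ps_def using path_cost_eq_sum[of "move_cost ?A ?w" "\<lambda>t s. f s t" 0 "length ?R"]
    by simp
  also have "\<dots> = 1 / 2 * (\<Sum>s\<in>?A. \<Sum>t = 1..length ?R. ?w (fst s) * of_bool (f s t \<noteq> f s (t - 1)))"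
    unfolding move_cost_def sum_distrib_left[symmetric] by (subst sum.swap) (simp only: sum_distrib_left[symmetric])
  also have "\<dots> = cost ?I f"
    unfolding cost_def sum_distrib_left[symmetric] by (simp add: augment_def gap_instance_def)
  finally show "ereal (real m ^ l) \<le> ereal (cost ?I f)"
    by simp
qed

text \<open>No server starts at the first requested point, so total mass 1 must arrive there at time
  1, in classes of weight at least 1.\<close>

lemma lp_opt_gap_instance_pos:
  assumes "1 \<le> m" and "\<And>j. 0 < n j" and "\<And>j. n j \<le> n (Suc j)"
  shows "0 < lp_opt (gap_instance l n k m)"
proof -
  let ?I = "gap_instance l n k m"
  have "phase n m l [1..<Suc (n l)] \<noteq> []"
    using assms by (intro phase_nonempty) auto
  then have h: "1 \<in> {1..horizon ?I}"
    by (simp add: gap_instance_def Suc_le_eq)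
  define r where "r = req ?I 1"
  have r: "r \<in> {1..n l}"
    using gap_instance_req[OF h] by (simp add: r_def)
  then have rp: "r \<in> points ?I"
    by (simp add: points_def gap_instance_def)
  have "1 / 2 \<le> lp_cost ?I x" if x: "lp_feasible ?I x" for x
  proof -
    let ?D = "\<lambda>j t v. \<bar>x v j t - x v j (t - 1)\<bar>"
    have "1 \<le> (\<Sum>j\<in>classes ?I. x r j 1)"
      using x h by (auto simp: lp_feasible_def r_def)
    also have "\<dots> \<le> (\<Sum>j\<in>classes ?I. wt ?I j * (\<Sum>t = 1..horizon ?I. \<Sum>v\<in>points ?I. ?D j t v))"
    proof (rule sum_mono)
      fix j assume j: "j \<in> classes ?I"
      have "x r j 0 = 0"
        using x rp j r by (auto simp: lp_feasible_def gap_instance_def)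
      then have "x r j 1 \<le> ?D j 1 r"
        by simp
      also have "\<dots> \<le> (\<Sum>v\<in>points ?I. ?D j 1 v)"
        using rp by (intro member_le_sum) (auto simp: points_def)
      also have "\<dots> \<le> (\<Sum>t = 1..horizon ?I. \<Sum>v\<in>points ?I. ?D j t v)"
        using h by (intro member_le_sum[where f = "\<lambda>t. \<Sum>v\<in>points ?I. ?D j t v"]) (auto intro: sum_nonneg)
      also have "\<dots> \<le> wt ?I j * (\<Sum>t = 1..horizon ?I. \<Sum>v\<in>points ?I. ?D j t v)"
      proof -
        have "1 \<le> real m ^ (j - 1)"
          using assms(1) by (intro one_le_power) simp
        then have "1 \<le> wt ?I j"
          by (simp add: gap_instance_def)
        then show ?thesis
          using mult_right_mono[of 1 "wt ?I j" "\<Sum>t = 1..horizon ?I. \<Sum>v\<in>points ?I. ?D j t v"]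
          by (simp add: sum_nonneg)
      qed
      finally show "x r j 1 \<le> wt ?I j * (\<Sum>t = 1..horizon ?I. \<Sum>v\<in>points ?I. ?D j t v)" .
    qed
    finally show ?thesis
      by (simp add: lp_cost_def)
  qed
  then have "ereal (1 / 2) \<le> lp_opt ?I"
    unfolding lp_opt_def by (intro INF_greatest) auto
  then show ?thesis
    by (rule less_le_trans[rotated]) simp
qed

lemma lp_opt_gap_instance_le:
  assumes "1 \<le> l" and n0: "n 0 = 1" and n: "\<And>j. n (Suc j) = l * k (Suc j)"
  shows "lp_opt (gap_instance l n k m) \<le> ereal (frac_bound n k l * real m ^ (l - 1))"
proof -
  let ?I = "gap_instance l n k m"
  let ?S = "[1..<Suc (n l)]"
  let ?R = "phase n m l ?S"
  let ?V = "points ?I"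
  let ?w = "\<lambda>j. 2 * real m ^ (j - 1)"
  define c :: fconfig where "c i v = (if v = Suc (n l) then real (k i) else 0)" for i v
  define cs where "cs = schedule l n m l c ?S"
  \<comment> \<open>Prepending \<open>c\<close> aligns list index with time: entry 0 is the start
    and entry \<open>t\<close> answers request \<open>t\<close>.\<close>
  define x where "x v j t = ((c # cs) ! t) j v" for v j t
  have V: "finite ?V"
    by (simp add: points_def)
  have c: "frac_valid ?V l k c"
    by (auto simp: frac_valid_def c_def V)
  have cs: "frac_valid ?V l k c'" if "c' \<in> set cs" for c'
    using that assms(1) unfolding cs_def
    by (intro schedule_valid[where n = n and S = ?S and j = l, OF V _ n c]) auto
  have serves: "list_all2 (\<lambda>c' r. 1 \<le> (\<Sum>i = 1..l. c' i r)) cs ?R"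
    unfolding cs_def using assms(1) n0 by (intro schedule_serves) auto
  then have len: "length cs = length ?R"
    by (rule list_all2_lengthD)
  have valid: "frac_valid ?V l k ((c # cs) ! t)" if "t \<le> horizon ?I" for t
  proof -
    have "(c # cs) ! t \<in> set (c # cs)"
      using that len by (intro nth_mem) (simp add: gap_instance_def)
    then show ?thesis
      using c cs by auto
  qed
  have "1 \<le> (\<Sum>j\<in>classes ?I. x (req ?I t) j t)" if "t \<in> {1..horizon ?I}" for t
    using that list_all2_nthD2[OF serves, of "t - 1"]
    by (auto simp: x_def gap_instance_def classes_def nth_Cons')
  moreover have "x v j 0 = real (card {i\<in>{1..num ?I j}. start ?I (j, i) = v})" for v j
    by (cases "v = Suc (n l)") (auto simp: x_def c_def gap_instance_def simp flip: atLeastAtMost_iff)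
  ultimately have "lp_feasible ?I x"
    using valid unfolding lp_feasible_def
    by (auto simp: x_def frac_valid_def gap_instance_def classes_def)
  then have "lp_opt ?I \<le> ereal (lp_cost ?I x)"
    unfolding lp_opt_def by (intro INF_lower) auto
  also have "lp_cost ?I x = (\<Sum>t = 1..length cs. frac_cost ?V l ?w ((c # cs) ! (t - 1)) ((c # cs) ! t))"
    unfolding frac_cost_def sum_distrib_left[symmetric] lp_cost_def
    by (subst sum.swap) (simp add: gap_instance_def classes_def x_def len sum_distrib_left)
  also have "\<dots> = path_cost (frac_cost ?V l ?w) c cs"
  proof -
    have "map ((!) (c # cs)) [Suc 0..<Suc (length cs)] = cs"
      by (rule nth_equalityI) (auto simp del: upt_Suc)
    then show ?thesis
      using path_cost_eq_sum[of "frac_cost ?V l ?w" "(!) (c # cs)" 0 "length cs"] by simp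
  qed
  also have "\<dots> \<le> frac_bound n k l * real m ^ (l - 1)"
    unfolding cs_def using assms(1) n c
    by (intro schedule_cost_le V) auto
  finally show ?thesis
    by simp
qed

theorem theorem1p2:
  fixes \<epsilon> C :: real and l :: nat
  assumes "\<epsilon> > 0" and "l \<ge> 1"
  shows "\<exists>I. wks_instance I \<and> ncls I = l \<and> 0 < lp_opt I \<and>
           (\<epsilon> < real l \<longrightarrow> (\<forall>j\<in>classes I. 1 \<le> \<lfloor>(real l - \<epsilon>) * real (num I j)\<rfloor>)) \<and>
           (\<forall>g. g \<in> servers (augment (real l - \<epsilon>) g I) \<rightarrow> points I \<longrightarrow>
              int_opt (augment (real l - \<epsilon>) g I) / lp_opt I > ereal C)"
proof -
  \<comment> \<open>\<open>a1\<close> ensures \<open>real l \<le> \<epsilon> * real a\<close>, which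
    yields \<open>n j \<le> \<epsilon> * k (Suc j)\<close>. \<open>a2\<close> ensures that for
    \<open>\<epsilon> < l\<close> each augmented class has a server.\<close>
  obtain a1 :: nat where a1: "real l / \<epsilon> < real a1"
    using reals_Archimedean2 by blast
  obtain a2 :: nat where a2: "1 / (real l - \<epsilon>) < real a2"
    using reals_Archimedean2 by blast
  define a where "a = Suc (a1 + a2)"
  define k where "k j = a ^ j" for j :: nat
  define n where "n j = (if j = 0 then 1 else l * k j)" for j
  define D where "D = frac_bound n k l"
  \<comment> \<open>\<open>D\<close> does not depend on \<open>m\<close>, so \<open>m\<close> is
    chosen last, making \<open>m / D\<close> exceed \<open>C\<close>; the added 2 keeps the weights
    distinct.\<close>
  obtain m0 :: nat where m0: "C * D < real m0"
    using reals_Archimedean2 by blast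
  define m where "m = m0 + 2"
  let ?I = "gap_instance l n k m"
  have "1 \<le> a" and "real a1 \<le> real a" and "real a2 \<le> real a"
    by (auto simp: a_def)
  then have "real l / \<epsilon> \<le> real a" and "1 / (real l - \<epsilon>) \<le> real a"
    using a1 a2 by linarith+
  with \<open>1 \<le> a\<close> have a: "1 \<le> a" "real l \<le> \<epsilon> * real a"
    "\<epsilon> < real l \<longrightarrow> 1 \<le> (real l - \<epsilon>) * real a"
    using assms(1) by (auto simp: field_simps)
  have k1: "1 \<le> k j" for j
    using a(1) by (simp add: k_def)
  have n0: "n 0 = 1" and n: "n (Suc j) = l * k (Suc j)" for j
    by (auto simp: n_def)
  have step: "real (n j) \<le> \<epsilon> * real (k (Suc j))" for j
  proof -
    have "n j \<le> l * a ^ j"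
      using assms(2) by (simp add: n_def k_def)
    then have "real (n j) \<le> real l * real a ^ j"
      by (metis of_nat_le_iff of_nat_mult of_nat_power)
    also have "\<dots> \<le> (\<epsilon> * real a) * real a ^ j"
      using a(2) by (intro mult_right_mono) auto
    finally show ?thesis
      by (simp add: k_def)
  qed
  have mono: "n j \<le> n (Suc j)" for j
    using assms(2) a(1) by (simp add: n_def k_def)
  have few: "nat \<lfloor>(real l - \<epsilon>) * real (k (Suc j))\<rfloor> + n j \<le> n (Suc j)" for j
  proof -
    have "(real l - \<epsilon>) * real (k (Suc j)) \<le> real (n (Suc j)) - real (n j)"
      using step[of j] by (simp add: n algebra_simps)
    then have "\<lfloor>(real l - \<epsilon>) * real (k (Suc j))\<rfloor> \<le> int (n (Suc j)) - int (n j)"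
      by linarith
    \<comment> \<open>When the floor is negative, \<open>nat\<close> gives 0 and \<open>mono\<close>
      settles the claim.\<close>
    then show ?thesis
      using mono[of j] by linarith
  qed
  have D: "0 < D"
  proof -
    obtain l' where "l = Suc l'"
      using assms(2) by (cases l) auto
    then show ?thesis
      using k1[of l] frac_bound_nonneg[of n k l'] by (simp add: D_def add_pos_nonneg)
  qed
  have pos: "0 < lp_opt ?I"
    using mono assms(2) k1 by (intro lp_opt_gap_instance_pos) (auto simp: m_def n_def Suc_le_eq)
  have le: "lp_opt ?I \<le> ereal (D * real m ^ (l - 1))"
    unfolding D_def using assms(2) by (intro lp_opt_gap_instance_le n0 n)
  have "ereal C < int_opt (augment (real l - \<epsilon>) g ?I) / lp_opt ?I" for g
  proof -
    \<comment> \<open>Positivity and the upper bound exclude 0 and infinity as denominator of the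
      \<open>ereal\<close> quotient.\<close>
    obtain q where q: "lp_opt ?I = ereal q"
      using pos le by (cases "lp_opt ?I") auto
    then have q0: "0 < q" and qle: "q \<le> D * real m ^ (l - 1)"
      using pos le by auto
    have "C < real m / D"
      using m0 D by (simp add: m_def field_simps)
    also have "\<dots> = real m ^ l / (D * real m ^ (l - 1))"
      using assms(2) D by (cases l) (simp_all add: m_def)
    also have "\<dots> \<le> real m ^ l / q"
      using q0 qle by (intro divide_left_mono) (auto simp: m_def D)
    finally have "ereal C < ereal (real m ^ l) / lp_opt ?I"
      using q q0 by simp
    also have "\<dots> \<le> int_opt (augment (real l - \<epsilon>) g ?I) / lp_opt ?I"
      by (intro ereal_divide_right_mono int_opt_gap_instance_ge n0 few pos)
    finally show ?thesis .
  qed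
  moreover have "1 \<le> \<lfloor>(real l - \<epsilon>) * real (num ?I j)\<rfloor>" if "\<epsilon> < real l" "j \<in> classes ?I" for j
  proof -
    have "a \<le> k j"
      using that(2) a(1) by (auto simp: k_def classes_def gap_instance_def intro: self_le_power)
    then have "(real l - \<epsilon>) * real a \<le> (real l - \<epsilon>) * real (k j)"
      using that(1) by (intro mult_left_mono) auto
    then have "1 \<le> (real l - \<epsilon>) * real (k j)"
      using a(3) that(1) by linarith
    then show ?thesis
      by (simp add: gap_instance_def)
  qed
  moreover have "wks_instance ?I"
    by (intro wks_instance_gap_instance k1) (simp add: m_def)
  moreover have "ncls ?I = l"
    by (simp add: gap_instance_def)
  ultimately show ?thesis
    using pos by blast
qed

end
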